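(* Let $G$ be a cubic graph. The following are equivalent: (a) $G$ has an equiangular $\mathbb{S}^2$-immersion $\gamma$ with $\gamma(V(G))$ consisting of exactly one point; (b) $G$ has an equiangular $\mathbb{S}^2$-immersion $\gamma$ with $\gamma(V(G))$ consisting of exactly two points; (c) $G$ is bipartite.
   Context: A great circle is $\pi\cap\mathbb{S}^2$ for a plane $\pi$ through the origin; a geodesic arc is a closed nonempty connected subset of a great circle (a whole great circle allowed). A directed geodesic arc is a continuous $A:[0,1]\to\mathbb{S}^2$, injective on $[0,1)$, with image a geodesic arc, parametrized proportionally to arc length (so an arc with $A(0)=A(1)$ traverses a full great circle). An $\mathbb{S}^2$-immersion of an orientation $\vec G$ maps each vertex $v$ to $\gamma(v)\in\mathbb{S}^2$ and each edge from $u$ to $w$ to a directed geodesic arc from $\gamma(u)$ to $\gamma(w)$; distinct vertices may share images. It is equiangular if at every vertex $v$ the three arcs leaving $\gamma(v)$ along the edges at $v$ (initial thirds $A([0,1/3])$ for tail ends, final thirds $A([2/3,1])$ for head ends) pairwise form spherical angle $2\pi/3$, the spherical angle being the angle between unit tangent vectors at $\gamma(v)$ pointing away from $\gamma(v)$. A graph has such an immersion if some orientation does. *)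

theory Defs
  imports "HOL-Analysis.Analysis" "HOL-Library.Uprod" "Graph_Theory.Digraph"
begin

section \<open>Cubic graphs and orientations\<close>

text \<open>
  Graphs are finite, have at least one vertex, and may have parallel edges and loops; a loop at
  \<open>v\<close> has \<open>ends G e = Upair v v\<close>. Simple graphs are the special case in which \<open>ends G\<close> is injective
  on the edges and never takes a value \<open>Upair v v\<close>.
\<close>

record ('v, 'e) multigraph =
  vertices :: "'v set"
  edges :: "'e set"
  ends :: "'e \<Rightarrow> 'v uprod"

definition finite_graph :: "('v, 'e) multigraph \<Rightarrow> bool" where
  "finite_graph G \<longleftrightarrow>
     finite (vertices G) \<and> vertices G \<noteq> {} \<and> finite (edges G) \<and>
     (\<forall>e\<in>edges G. set_uprod (ends G e) \<subseteq> vertices G)"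

text \<open>The second summand makes a loop contribute two to the degree of its vertex.\<close>

definition degree :: "('v, 'e) multigraph \<Rightarrow> 'v \<Rightarrow> nat" where
  "degree G v = card {e \<in> edges G. v \<in> set_uprod (ends G e)} +
                card {e \<in> edges G. ends G e = Upair v v}"

definition cubic_graph :: "('v, 'e) multigraph \<Rightarrow> bool" where
  "cubic_graph G \<longleftrightarrow> finite_graph G \<and> (\<forall>v\<in>vertices G. degree G v = 3)"

definition bipartite :: "('v, 'e) multigraph \<Rightarrow> bool" where
  "bipartite G \<longleftrightarrow>
     (\<exists>X Y. X \<union> Y = vertices G \<and> X \<inter> Y = {} \<and>
        (\<forall>e\<in>edges G. \<exists>x\<in>X. \<exists>y\<in>Y. ends G e = Upair x y))"

definition orientation_of :: "('v, 'e) pre_digraph \<Rightarrow> ('v, 'e) multigraph \<Rightarrow> bool" where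
  "orientation_of D G \<longleftrightarrow>
     verts D = vertices G \<and> arcs D = edges G \<and>
     (\<forall>e\<in>edges G. ends G e = Upair (tail D e) (head D e))"

section \<open>Directed geodesic arcs\<close>

definition great_circle :: "(real^3) set \<Rightarrow> bool" where
  "great_circle C \<longleftrightarrow> (\<exists>P. subspace P \<and> dim P = 2 \<and> C = P \<inter> sphere 0 1)"

definition geodesic_arc :: "(real^3) set \<Rightarrow> bool" where
  "geodesic_arc S \<longleftrightarrow>
     closed S \<and> S \<noteq> {} \<and> connected S \<and> (\<exists>C. great_circle C \<and> S \<subseteq> C)"

text \<open>Length of \<open>g\<close> on \<open>{a..b}\<close>, as the supremum of the lengths of the inscribed polygons.\<close>

definition arc_length :: "(real \<Rightarrow> 'a::metric_space) \<Rightarrow> real \<Rightarrow> real \<Rightarrow> ereal" where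
  "arc_length g a b =
     (SUP (n, s) \<in> {(n::nat, s::nat \<Rightarrow> real). mono_on {..n} s \<and> s 0 = a \<and> s n = b}.
        ereal (\<Sum>i<n. dist (g (s i)) (g (s (Suc i)))))"

text \<open>The length \<open>L\<close> of the whole curve (\<open>t = 1\<close>) is required to be finite.\<close>

definition proportional_to_arc_length :: "(real \<Rightarrow> 'a::metric_space) \<Rightarrow> bool" where
  "proportional_to_arc_length g \<longleftrightarrow>
     (\<exists>L::real. \<forall>t\<in>{0..1}. arc_length g 0 t = ereal (t * L))"

definition directed_geodesic_arc :: "(real \<Rightarrow> real^3) \<Rightarrow> bool" where
  "directed_geodesic_arc A \<longleftrightarrow>
     path A \<and> inj_on A {0..<1} \<and> geodesic_arc (path_image A) \<and>
     proportional_to_arc_length A"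

section \<open>Equiangular immersions\<close>

definition immersion ::
  "('v, 'e) pre_digraph \<Rightarrow> ('v \<Rightarrow> real^3) \<Rightarrow> ('e \<Rightarrow> real \<Rightarrow> real^3) \<Rightarrow> bool" where
  "immersion D \<gamma> A \<longleftrightarrow>
     (\<forall>v\<in>verts D. \<gamma> v \<in> sphere 0 1) \<and>
     (\<forall>e\<in>arcs D. directed_geodesic_arc (A e) \<and>
        pathstart (A e) = \<gamma> (tail D e) \<and> pathfinish (A e) = \<gamma> (head D e))"

text \<open>Each edge has two ends, which are kept apart even if the edge is a loop.\<close>

datatype 'e edge_end = Tail_end 'e | Head_end 'e

definition ends_at :: "('v, 'e) pre_digraph \<Rightarrow> 'v \<Rightarrow> 'e edge_end set" where
  "ends_at D v = Tail_end ` {e \<in> arcs D. tail D e = v} \<union> Head_end ` {e \<in> arcs D. head D e = v}"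

text \<open>
  The initial third of an arc at its tail end, the final third at its head end. The final third is
  traversed backwards, so that in both cases the curve starts at the image of the vertex.
\<close>

fun leaving_arc :: "('e \<Rightarrow> real \<Rightarrow> real^3) \<Rightarrow> 'e edge_end \<Rightarrow> real \<Rightarrow> real^3" where
  "leaving_arc A (Tail_end e) = subpath 0 (1/3) (A e)"
| "leaving_arc A (Head_end e) = subpath 1 (2/3) (A e)"

definition unit_tangent :: "(real \<Rightarrow> real^3) \<Rightarrow> real^3" where
  "unit_tangent B = sgn (vector_derivative B (at 0 within {0..1}))"

definition spherical_angle :: "(real \<Rightarrow> real^3) \<Rightarrow> (real \<Rightarrow> real^3) \<Rightarrow> real" where
  "spherical_angle B B' = arccos (unit_tangent B \<bullet> unit_tangent B')"

definition equiangular :: "('v, 'e) pre_digraph \<Rightarrow> ('e \<Rightarrow> real \<Rightarrow> real^3) \<Rightarrow> bool" where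
  "equiangular D A \<longleftrightarrow>
     (\<forall>v\<in>verts D. pairwise
        (\<lambda>h h'. spherical_angle (leaving_arc A h) (leaving_arc A h') = 2 * pi / 3) (ends_at D v))"

definition equiangular_immersion :: "('v, 'e) multigraph \<Rightarrow> ('v \<Rightarrow> real^3) \<Rightarrow> bool" where
  "equiangular_immersion G \<gamma> \<longleftrightarrow>
     (\<exists>D A. orientation_of D G \<and> immersion D \<gamma> A \<and> equiangular D A)"

end

theory Submission
  imports Defs
begin

text \<open>
  A directed geodesic arc from \<open>p\<close> is \<open>t \<mapsto> cos (t L) p + sin (t L) d\<close> with \<open>d\<close> a unit vector
  orthogonal to \<open>p\<close>. If it returns to \<open>p\<close>, the tangents at its two ends are opposite; if it leads to
  \<open>q \<noteq> p\<close>, they are exchanged by the reflection that exchanges \<open>p\<close> and \<open>q\<close>. Use this reflection to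
  move all tangents at \<open>q\<close> to \<open>p\<close>. The three tangents at a vertex form a triad of directions at mutual
  angle \<open>2 * pi / 3\<close>, which is determined by each of its members and differs from its negative. Along
  an edge either the triad is negated and the point kept, or the triad is kept and the point changed;
  so the parity of (point, sign of the triad) is a proper 2-colouring. The case of a single point \<open>p\<close>
  is the case \<open>{p, - p}\<close> with \<open>- p\<close> unused.

  Conversely, a bipartite cubic graph is 3-edge-colourable. Assign one of three directions at angle
  \<open>2 * pi / 3\<close> to each colour, and map each edge to the great circle through \<open>p\<close> (one point) or the half
  circle from \<open>p\<close> to \<open>- p\<close> (two points) in the direction of its colour.
\<close>

section \<open>Edge colourings of regular bipartite graphs\<close>

text \<open>Rado's argument: shrink the sets one element at a time, keeping Hall's condition, until
  all are singletons. If removing either of two elements of \<open>A i\<close> destroyed the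
  condition, submodularity of cardinality would give a contradiction.\<close>

theorem hall_marriage:
  assumes "finite I" and "\<And>i. i \<in> I \<Longrightarrow> finite (A i)"
    and "\<And>J. J \<subseteq> I \<Longrightarrow> card J \<le> card (\<Union> (A ` J))"
  shows "\<exists>f. inj_on f I \<and> (\<forall>i\<in>I. f i \<in> A i)"
  using assms(2,3)
proof (induction "\<Sum>i\<in>I. card (A i)" arbitrary: A rule: less_induct)
  case less
  show ?case
  proof (cases "\<exists>i\<in>I. \<exists>x\<in>A i. \<exists>y\<in>A i. x \<noteq> y")
    case False
    have "\<exists>x. x \<in> A i" if "i \<in> I" for i
      using less.prems(2)[of "{i}"] that by (cases "A i = {}") auto
    then obtain f where f: "\<And>i. i \<in> I \<Longrightarrow> f i \<in> A i"
      by metis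
    then have A_eq: "A i = {f i}" if "i \<in> I" for i
      using False that by fastforce
    have "inj_on f I"
    proof (rule inj_onI, rule ccontr)
      fix i j assume "i \<in> I" "j \<in> I" "f i = f j" "i \<noteq> j"
      then show False
        using less.prems(2)[of "{i, j}"] A_eq by auto
    qed
    with f show ?thesis by blast
  next
    case True
    then obtain i x y where i: "i \<in> I" and x: "x \<in> A i" and y: "y \<in> A i" and "x \<noteq> y"
      by blast
    define B where "B z = A(i := A i - {z})" for z
    have transversal: ?thesis
      if z: "z \<in> A i" and hall: "\<And>J. J \<subseteq> I \<Longrightarrow> card J \<le> card (\<Union> (B z ` J))" for z
    proof -
      have "(\<Sum>j\<in>I. card (B z j)) < (\<Sum>j\<in>I. card (A j))"
        using assms(1)
      proof (rule sum_strict_mono_ex1)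
        show "\<forall>j\<in>I. card (B z j) \<le> card (A j)"
          using less.prems(1) by (auto simp: B_def intro: card_mono)
        show "\<exists>j\<in>I. card (B z j) < card (A j)"
          using i card_Diff1_less[OF less.prems(1)[OF i] z] by (intro bexI[of _ i]) (simp_all add: B_def)
      qed
      moreover have "finite (B z j)" if "j \<in> I" for j
        using less.prems(1) that by (auto simp: B_def)
      ultimately obtain f where "inj_on f I" "\<forall>j\<in>I. f j \<in> B z j"
        using less.hyps hall by blast
      moreover have "B z j \<subseteq> A j" for j
        by (auto simp: B_def)
      ultimately show ?thesis by blast
    qed
    \<comment> \<open>A violating index set contains \<open>i\<close>, the only index whose set has
      shrunk. Dropping \<open>i\<close> from it weakens the strict inequality to
      \<open>\<le>\<close>.\<close>
    have deficient: "\<exists>J\<subseteq>I - {i}. card (\<Union> (A ` J) \<union> (A i - {z})) \<le> card J"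
      if "J \<subseteq> I" "\<not> card J \<le> card (\<Union> (B z ` J))" for J z
    proof -
      have "i \<in> J"
      proof (rule ccontr)
        assume "i \<notin> J"
        then have "\<Union> (B z ` J) = \<Union> (A ` J)" by (auto simp: B_def)
        with that less.prems(2) show False by metis
      qed
      then have "\<Union> (B z ` J) = \<Union> (A ` (J - {i})) \<union> (A i - {z})"
        by (auto simp: B_def split: if_splits)
      moreover have "card J = Suc (card (J - {i}))"
        using \<open>i \<in> J\<close> \<open>J \<subseteq> I\<close> assms(1) by (metis card_Suc_Diff1 finite_subset)
      ultimately show ?thesis
        using that by (intro exI[of _ "J - {i}"]) auto
    qed
    have violation: "\<exists>J\<subseteq>I - {i}. card (\<Union> (A ` J) \<union> (A i - {z})) \<le> card J"
      if no: "\<not> ?thesis" and z: "z \<in> A i" for z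
    proof (rule ccontr)
      assume none: "\<not> ?thesis"
      have "card J \<le> card (\<Union> (B z ` J))" if "J \<subseteq> I" for J
        by (rule ccontr) (use deficient[OF that] none in simp)
      from transversal[OF z this] no show False by contradiction
    qed
    show ?thesis
    proof (rule ccontr)
      assume no: "\<not> ?thesis"
      obtain J where J: "J \<subseteq> I - {i}" and cJ: "card (\<Union> (A ` J) \<union> (A i - {x})) \<le> card J"
        using violation[OF no x] by (elim exE conjE)
      obtain K where K: "K \<subseteq> I - {i}" and cK: "card (\<Union> (A ` K) \<union> (A i - {y})) \<le> card K"
        using violation[OF no y] by (elim exE conjE)
      let ?U = "\<Union> (A ` J) \<union> (A i - {x})" and ?W = "\<Union> (A ` K) \<union> (A i - {y})"
      have fin: "finite J" "finite K"
        using J K assms(1) finite_subset by blast+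
      have finU: "finite ?U" "finite ?W"
        using J K fin i less.prems(1) by auto
      \<comment> \<open>As \<open>x \<noteq> y\<close>, the union recovers all of
        \<open>A i\<close>, so Hall's condition applies to \<open>insert i (J \<union> K)\<close>.
        The extra index makes \<open>card ?U + card ?W\<close> exceed
        \<open>card J + card K\<close>.\<close>
      have "?U \<union> ?W = \<Union> (A ` insert i (J \<union> K))"
        using \<open>x \<noteq> y\<close> by auto
      moreover have "card (insert i (J \<union> K)) = Suc (card (J \<union> K))"
        using J K fin by (intro card_insert_disjoint) auto
      moreover have "insert i (J \<union> K) \<subseteq> I"
        using J K i by auto
      ultimately have "Suc (card (J \<union> K)) \<le> card (?U \<union> ?W)"
        using less.prems(2) by metis
      moreover have "card (J \<inter> K) \<le> card (?U \<inter> ?W)"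
      proof -
        have "card (J \<inter> K) \<le> card (\<Union> (A ` (J \<inter> K)))"
          using J by (intro less.prems(2)) auto
        also have "\<dots> \<le> card (?U \<inter> ?W)"
          using finU by (intro card_mono) auto
        finally show ?thesis .
      qed
      ultimately show False
        using cJ cK card_Un_Int[OF finU] card_Un_Int[OF fin] by linarith
    qed
  qed
qed

section \<open>Double counting, perfect matchings and Koenig's theorem\<close>

lemma card_eq_sum_fibres:
  assumes "finite E" "finite X" "a ` E \<subseteq> X"
  shows "card E = (\<Sum>x\<in>X. card {e \<in> E. a e = x})"
  using sum.group[OF assms, of "\<lambda>_. 1 :: nat"] by simp

lemma card_preimage_regular:
  assumes "finite E" "finite J" and "\<And>x. x \<in> J \<Longrightarrow> card {e \<in> E. a e = x} = k"
  shows "card {e \<in> E. a e \<in> J} = card J * k"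
proof -
  have "{e \<in> {e \<in> E. a e \<in> J}. a e = x} = {e \<in> E. a e = x}" if "x \<in> J" for x
    using that by blast
  then have "(\<Sum>x\<in>J. card {e \<in> {e \<in> E. a e \<in> J}. a e = x}) = card J * k"
    using assms(3) by simp
  moreover have "card {e \<in> E. a e \<in> J} = (\<Sum>x\<in>J. card {e \<in> {e \<in> E. a e \<in> J}. a e = x})"
    using assms(1,2) by (intro card_eq_sum_fibres) auto
  ultimately show ?thesis by simp
qed

text \<open>The \<open>card J * k\<close> edges leaving \<open>J\<close> end in its neighbourhood,
  which receives only \<open>k\<close> edges per vertex; this is Hall's condition. Edges are
  abstract elements with endpoint maps, which allows parallel edges.\<close>

lemma regular_bipartite_matching:
  fixes a :: "'e \<Rightarrow> 'x" and b :: "'e \<Rightarrow> 'y"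
  assumes fin: "finite E" "finite X" "finite Y" and "k > 0"
    and a: "a ` E \<subseteq> X" "\<And>x. x \<in> X \<Longrightarrow> card {e \<in> E. a e = x} = k"
    and b: "b ` E \<subseteq> Y" "\<And>y. y \<in> Y \<Longrightarrow> card {e \<in> E. b e = y} = k"
  shows "\<exists>M\<subseteq>E. bij_betw a M X \<and> bij_betw b M Y"
proof -
  define N where "N x = b ` {e \<in> E. a e = x}" for x
  have "card J \<le> card (\<Union> (N ` J))" if J: "J \<subseteq> X" for J
  proof -
    have "card J * k = card {e \<in> E. a e \<in> J}"
      using J a(2) fin(1) finite_subset[OF J fin(2)] by (intro card_preimage_regular[symmetric]) blast+
    also have "\<dots> \<le> card {e \<in> E. b e \<in> \<Union> (N ` J)}"
      using fin by (intro card_mono) (auto simp: N_def)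
    also have "\<dots> = card (\<Union> (N ` J)) * k"
    proof -
      have "\<Union> (N ` J) \<subseteq> Y" using b(1) by (auto simp: N_def)
      moreover from this have "finite (\<Union> (N ` J))" using fin finite_subset by blast
      ultimately show ?thesis
        using b(2) fin(1) by (intro card_preimage_regular) blast+
    qed
    finally show ?thesis using \<open>k > 0\<close> by simp
  qed
  then obtain f where f: "inj_on f X" "\<And>x. x \<in> X \<Longrightarrow> f x \<in> N x"
    using hall_marriage[of X N] fin by (auto simp: N_def)
  then have "\<exists>e. e \<in> E \<and> a e = x \<and> b e = f x" if "x \<in> X" for x
    using that by (force simp: N_def)
  then obtain m where m: "\<And>x. x \<in> X \<Longrightarrow> m x \<in> E \<and> a (m x) = x \<and> b (m x) = f x"
    by metis
  \<comment> \<open>Both sides count \<open>E\<close>. Hence the injection \<open>f\<close> is onto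
    \<open>Y\<close>, and the matching covers \<open>Y\<close> too.\<close>
  have "card X * k = card Y * k"
    using card_eq_sum_fibres[OF fin(1,2) a(1)] card_eq_sum_fibres[OF fin(1,3) b(1)] a(2) b(2)
    by auto
  then have "card (f ` X) = card Y"
    using \<open>k > 0\<close> card_image[OF f(1)] by simp
  moreover have "f ` X \<subseteq> Y"
    using m b(1) by force
  ultimately have "f ` X = Y"
    using fin card_subset_eq by metis
  moreover have "bij_betw a (m ` X) X"
    using m by (auto simp: bij_betw_def inj_on_def image_iff)
  moreover have "bij_betw b (m ` X) (f ` X)"
    using m f(1) by (auto simp: bij_betw_def inj_on_def image_iff)
  ultimately show ?thesis
    using m by (intro exI[of _ "m ` X"]) auto
qed

text \<open>Induction on \<open>k\<close>: a perfect matching forms one colour class, and removing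
  it lowers every degree by one.\<close>

theorem koenig_edge_colouring:
  fixes a :: "'e \<Rightarrow> 'x" and b :: "'e \<Rightarrow> 'y"
  assumes "finite E" and fin: "finite X" "finite Y"
    and "a ` E \<subseteq> X" "\<And>x. x \<in> X \<Longrightarrow> card {e \<in> E. a e = x} = k"
    and "b ` E \<subseteq> Y" "\<And>y. y \<in> Y \<Longrightarrow> card {e \<in> E. b e = y} = k"
  shows "\<exists>c. (\<forall>e\<in>E. c e < k) \<and>
    (\<forall>e\<in>E. \<forall>e'\<in>E. e \<noteq> e' \<longrightarrow> a e = a e' \<or> b e = b e' \<longrightarrow> c e \<noteq> c e')"
  using assms(1,4-)
proof (induction k arbitrary: E)
  case 0
  then have "E = {}" by fastforce
  then show ?case by simp
next
  case (Suc k)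
  obtain M where M: "M \<subseteq> E" "bij_betw a M X" "bij_betw b M Y"
    using regular_bipartite_matching[OF Suc.prems(1) fin _ Suc.prems(2-)] by blast
  have reduce: "card {e \<in> E - M. g e = z} = k"
    if g: "bij_betw g M Z" and z: "z \<in> Z" and card: "card {e \<in> E. g e = z} = Suc k"
    for g :: "'e \<Rightarrow> 'z" and Z z
  proof -
    obtain m where m: "m \<in> M" "g m = z"
      using g z by (auto simp: bij_betw_def)
    then have "{e \<in> E - M. g e = z} = {e \<in> E. g e = z} - {m}"
      using g by (auto simp: bij_betw_def inj_on_def)
    then show ?thesis
      using m M(1) card by (auto simp: card_Diff_singleton)
  qed
  have "\<exists>c. (\<forall>e\<in>E - M. c e < k) \<and>
    (\<forall>e\<in>E - M. \<forall>e'\<in>E - M. e \<noteq> e' \<longrightarrow> a e = a e' \<or> b e = b e' \<longrightarrow> c e \<noteq> c e')"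
    using Suc.prems reduce[OF M(2)] reduce[OF M(3)] by (intro Suc.IH) auto
  then obtain c where c: "\<forall>e\<in>E - M. c e < k"
    "\<forall>e\<in>E - M. \<forall>e'\<in>E - M. e \<noteq> e' \<longrightarrow> a e = a e' \<or> b e = b e' \<longrightarrow> c e \<noteq> c e'"
    by (elim exE conjE)
  have inj: "inj_on a M" "inj_on b M"
    using M by (auto simp: bij_betw_def)
  define c' where "c' e = (if e \<in> M then k else c e)" for e
  have "c' e \<noteq> c' e'"
    if "e \<in> E" "e' \<in> E" "e \<noteq> e'" "a e = a e' \<or> b e = b e'" for e e'
  proof (cases "e \<in> M"; cases "e' \<in> M")
    assume "e \<in> M" "e' \<in> M"
    with inj that show ?thesis by (auto simp: inj_on_def)
  next
    assume "e \<notin> M" "e' \<notin> M"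
    with that bspec[OF bspec[OF c(2), of e], of e'] show ?thesis by (auto simp: c'_def)
  qed (use c(1) that in \<open>force simp: c'_def\<close>)+
  moreover have "\<forall>e\<in>E. c' e < Suc k"
    using c(1) by (auto simp: c'_def less_Suc_eq)
  ultimately show ?case by auto
qed

section \<open>Directed geodesic arcs in coordinates\<close>

text \<open>For orthonormal \<open>p\<close> and \<open>d\<close>, the unit circle in their plane,
  parametrized by the angle from \<open>p\<close> towards \<open>d\<close>.\<close>

definition circ :: "'a::real_inner \<Rightarrow> 'a \<Rightarrow> real \<Rightarrow> 'a" where
  "circ p d x = cos x *\<^sub>R p + sin x *\<^sub>R d"

lemma continuous_on_circ [continuous_intros]:
  fixes f :: "'b::t2_space \<Rightarrow> real"
  shows "continuous_on S f \<Longrightarrow> continuous_on S (\<lambda>x. circ p d (f x))"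
  unfolding circ_def by (auto intro!: continuous_intros)

definition orthonormal_pair :: "'a::real_inner \<Rightarrow> 'a \<Rightarrow> bool" where
  "orthonormal_pair p d \<longleftrightarrow> norm p = 1 \<and> norm d = 1 \<and> p \<bullet> d = 0"

lemma orthonormal_pairD:
  assumes "orthonormal_pair p d"
  shows "p \<bullet> p = 1" "d \<bullet> d = 1" "p \<bullet> d = 0" "d \<bullet> p = 0" "norm p = 1" "norm d = 1"
  using assms by (auto simp: orthonormal_pair_def norm_eq_1 inner_commute)

section \<open>Chords and arc length on a unit circle\<close>

lemma inner_circ_circ:
  assumes "orthonormal_pair p d"
  shows "circ p d x \<bullet> circ p d y = cos (x - y)"
  by (simp add: circ_def inner_add_left inner_add_right orthonormal_pairD[OF assms] cos_diff)

lemma norm_circ: "orthonormal_pair p d \<Longrightarrow> norm (circ p d x) = 1"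
  by (simp add: norm_eq_1 inner_circ_circ)

lemma dist_circ:
  assumes "orthonormal_pair p d"
  shows "dist (circ p d x) (circ p d y) = 2 * \<bar>sin ((x - y) / 2)\<bar>"
proof -
  have "(dist (circ p d x) (circ p d y))\<^sup>2 = 2 - 2 * cos (x - y)"
    by (simp add: dist_norm power2_norm_eq_inner inner_diff_left inner_diff_right
        inner_circ_circ[OF assms] cos_diff)
  also have "\<dots> = (2 * \<bar>sin ((x - y) / 2)\<bar>)\<^sup>2"
  proof -
    define z where "z = (x - y) / 2"
    have "x - y = 2 * z" by (simp add: z_def)
    then show ?thesis
      unfolding z_def[symmetric] by (simp add: cos_double_sin power_mult_distrib)
  qed
  finally show ?thesis
    by (rule power2_eq_imp_eq) auto
qed

text \<open>A chord is no longer than the angle it subtends, since |sin x| <= |x|, and the angles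
  telescope.\<close>

lemma arc_length_circ_le:
  assumes pd: "orthonormal_pair p d" and mono: "mono_on {a..b} \<theta>" and "a \<le> b"
  shows "arc_length (\<lambda>t. circ p d (\<theta> t)) a b \<le> ereal (\<theta> b - \<theta> a)"
  unfolding arc_length_def
proof (rule SUP_least, clarsimp)
  fix n and s :: "nat \<Rightarrow> real"
  assume s: "mono_on {..n} s" and a: "a = s 0" and b: "b = s n"
  have "(\<Sum>i<n. dist (circ p d (\<theta> (s i))) (circ p d (\<theta> (s (Suc i)))))
      \<le> (\<Sum>i<n. \<theta> (s (Suc i)) - \<theta> (s i))"
  proof (rule sum_mono)
    fix i assume "i \<in> {..<n}"
    then have le: "s 0 \<le> s i" "s i \<le> s (Suc i)" "s (Suc i) \<le> s n"
      using s by (auto simp: mono_on_def)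
    then have "\<theta> (s i) \<le> \<theta> (s (Suc i))"
      using mono a b by (intro mono_onD[OF mono]) auto
    then show "dist (circ p d (\<theta> (s i))) (circ p d (\<theta> (s (Suc i)))) \<le> \<theta> (s (Suc i)) - \<theta> (s i)"
      using abs_sin_x_le_abs_x[of "(\<theta> (s i) - \<theta> (s (Suc i))) / 2"] dist_circ[OF pd]
      by simp
  qed
  also have "\<dots> = \<theta> (s n) - \<theta> (s 0)"
    by (rule sum_lessThan_telescope)
  finally show "(\<Sum>i<n. dist (circ p d (\<theta> (s i))) (circ p d (\<theta> (s (Suc i))))) \<le> \<theta> (s n) - \<theta> (s 0)" .
qed

lemma lim_sin_over_x: "((\<lambda>x::real. sin x / x) \<longlongrightarrow> 1) (at 0)"
  using DERIV_sin[of "0::real"] by (simp add: has_field_derivative_iff)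

text \<open>This is the length of \<open>Suc n\<close> equal chords that together subtend the angle
  \<open>x\<close>; it converges because sin z / z tends to 1 at 0.\<close>

lemma regular_polygon_limit:
  fixes x :: real
  shows "(\<lambda>n. real (Suc n) * (2 * \<bar>sin (x / real (Suc n) / 2)\<bar>)) \<longlonglongrightarrow> \<bar>x\<bar>"
proof (cases "x = 0")
  case False
  have "(\<lambda>n. x / 2 / real (Suc n)) \<longlonglongrightarrow> 0"
    using LIMSEQ_Suc[OF lim_const_over_n] .
  then have "filterlim (\<lambda>n. x / 2 / real (Suc n)) (at 0) sequentially"
    using False by (intro filterlim_atI) auto
  then have "(\<lambda>n. sin (x / 2 / real (Suc n)) / (x / 2 / real (Suc n))) \<longlonglongrightarrow> 1"
    by (rule filterlim_compose[OF lim_sin_over_x])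
  then have "(\<lambda>n. \<bar>x * (sin (x / 2 / real (Suc n)) / (x / 2 / real (Suc n)))\<bar>) \<longlonglongrightarrow> \<bar>x * 1\<bar>"
    by (intro tendsto_intros)
  moreover have "\<bar>x * (sin (x / 2 / real (Suc n)) / (x / 2 / real (Suc n)))\<bar>
      = real (Suc n) * (2 * \<bar>sin (x / real (Suc n) / 2)\<bar>)" for n
  proof -
    have "x * (sin (x / 2 / real (Suc n)) / (x / 2 / real (Suc n)))
        = real (Suc n) * (2 * sin (x / real (Suc n) / 2))"
      using False by (simp add: field_simps del: of_nat_Suc)
    then show ?thesis by (simp only: abs_mult abs_numeral abs_of_nat)
  qed
  ultimately show ?thesis by simp
qed simp

text \<open>Inscribed polygons with equal angular steps have lengths tending to the total angle. The
  intermediate value theorem supplies their parameters.\<close>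

lemma arc_length_circ_ge:
  assumes pd: "orthonormal_pair p d" and mono: "strict_mono_on {a..b} \<theta>"
    and cont: "continuous_on {a..b} \<theta>" and "a \<le> b"
  shows "ereal (\<theta> b - \<theta> a) \<le> arc_length (\<lambda>t. circ p d (\<theta> t)) a b"
proof -
  define \<delta> where "\<delta> = \<theta> b - \<theta> a"
  have "\<theta> a \<le> \<theta> b"
    using strict_mono_on_leD[OF mono] \<open>a \<le> b\<close> by auto
  then have \<delta>: "\<delta> \<ge> 0" by (simp add: \<delta>_def)
  have polygon: "ereal (real (Suc n) * (2 * \<bar>sin (\<delta> / real (Suc n) / 2)\<bar>))
      \<le> arc_length (\<lambda>t. circ p d (\<theta> t)) a b" for n
  proof -
    let ?N = "Suc n"
    have "\<exists>t\<in>{a..b}. \<theta> t = \<theta> a + real i * \<delta> / ?N" if "i \<le> ?N" for i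
    proof -
      have "real i * \<delta> / ?N \<le> \<delta>"
        using mult_right_mono[of "real i" ?N \<delta>] that \<delta> by (simp add: field_simps)
      then have "\<exists>t\<ge>a. t \<le> b \<and> \<theta> t = \<theta> a + real i * \<delta> / ?N"
        using \<delta> \<open>a \<le> b\<close> cont by (intro IVT') (auto simp: \<delta>_def)
      then show ?thesis by auto
    qed
    then obtain s where s: "\<And>i. i \<le> ?N \<Longrightarrow> s i \<in> {a..b} \<and> \<theta> (s i) = \<theta> a + real i * \<delta> / ?N"
      by metis
    \<comment> \<open>Injectivity of the angle identifies the first and last parameters with
      \<open>a\<close> and \<open>b\<close>, as \<open>arc_length\<close> demands.\<close>
    have inj: "x = y" if "x \<in> {a..b}" "y \<in> {a..b}" "\<theta> x = \<theta> y" for x y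
      using strict_mono_on_imp_inj_on[OF mono] that by (auto simp: inj_on_def)
    have "s 0 = a"
      using inj[of "s 0" a] s[of 0] \<open>a \<le> b\<close> by simp
    moreover have "s ?N = b"
      using inj[of "s ?N" b] s[of ?N] \<open>a \<le> b\<close> by (simp add: \<delta>_def)
    moreover have "mono_on {..?N} s"
    proof (rule mono_onI)
      fix i j assume "i \<in> {..?N}" "j \<in> {..?N}" "i \<le> j"
      then have "\<theta> (s i) \<le> \<theta> (s j)" "s i \<in> {a..b}" "s j \<in> {a..b}"
        using s[of i] s[of j] \<delta> by (auto intro!: divide_right_mono mult_right_mono)
      then show "s i \<le> s j"
        using strict_mono_onD[OF mono, of "s j" "s i"] by fastforce
    qed
    ultimately have "ereal (\<Sum>i<?N. dist (circ p d (\<theta> (s i))) (circ p d (\<theta> (s (Suc i)))))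
        \<le> arc_length (\<lambda>t. circ p d (\<theta> t)) a b"
      unfolding arc_length_def by (intro SUP_upper2[of "(?N, s)"]) auto
    moreover have "dist (circ p d (\<theta> (s i))) (circ p d (\<theta> (s (Suc i)))) = 2 * \<bar>sin (\<delta> / real ?N / 2)\<bar>"
      if "i < ?N" for i
    proof -
      have "(\<theta> (s i) - \<theta> (s (Suc i))) / 2 = - (\<delta> / real ?N / 2)"
        using s[of i] s[of "Suc i"] that by (simp add: field_simps)
      then show ?thesis
        using dist_circ[OF pd] by (metis abs_minus_cancel sin_minus)
    qed
    ultimately show ?thesis by simp
  qed
  have "(\<lambda>n. ereal (real (Suc n) * (2 * \<bar>sin (\<delta> / real (Suc n) / 2)\<bar>))) \<longlonglongrightarrow> ereal \<bar>\<delta>\<bar>"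
    using regular_polygon_limit by (intro tendsto_intros)
  from LIMSEQ_le_const2[OF this] polygon \<delta> show ?thesis
    by (auto simp: \<delta>_def)
qed

lemma arc_length_circ:
  assumes "orthonormal_pair p d" "strict_mono_on {a..b} \<theta>" "continuous_on {a..b} \<theta>" "a \<le> b"
  shows "arc_length (\<lambda>t. circ p d (\<theta> t)) a b = ereal (\<theta> b - \<theta> a)"
  using arc_length_circ_le[of p d a b \<theta>] arc_length_circ_ge[of p d a b \<theta>] assms
    strict_mono_on_imp_mono_on by (intro antisym) blast+

lemma arc_length_cong:
  assumes "\<And>t. t \<in> {a..b} \<Longrightarrow> f t = g t"
  shows "arc_length f a b = arc_length g a b"
  unfolding arc_length_def
proof (rule SUP_cong[OF refl], clarsimp)
  fix n and s :: "nat \<Rightarrow> real"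
  assume s: "mono_on {..n} s" and a: "a = s 0" and b: "b = s n"
  have "f (s i) = g (s i)" if "i \<le> n" for i
    using s a b that by (intro assms) (auto simp: mono_on_def)
  then show "(\<Sum>i<n. dist (f (s i)) (f (s (Suc i)))) = (\<Sum>i<n. dist (g (s i)) (g (s (Suc i))))"
    by (intro sum.cong) auto
qed

section \<open>Planes, orthonormal bases and geodesic arcs\<close>

lemma dim_span_orthonormal_pair:
  fixes p d :: "'a::euclidean_space"
  assumes "orthonormal_pair p d"
  shows "dim (span {p, d}) = 2"
proof -
  have "independent {p, d}"
    using orthonormal_pairD[OF assms]
    by (intro pairwise_orthogonal_independent) (auto simp: pairwise_def orthogonal_def)
  moreover have "p \<noteq> d"
    using orthonormal_pairD[OF assms] by auto
  ultimately show ?thesis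
    by (simp add: dim_eq_card_independent)
qed

lemma directed_geodesic_arc_circ:
  assumes pd: "orthonormal_pair p d" and L: "0 < L" "L \<le> 2 * pi"
  shows "directed_geodesic_arc (\<lambda>t. circ p d (t * L))"
proof -
  let ?A = "\<lambda>t. circ p d (t * L)"
  have path: "path ?A"
    unfolding path_def by (intro continuous_intros)
  have "inj_on ?A {0..<1}"
  proof (rule linorder_inj_onI)
    fix x y :: real assume "x < y" and "x \<in> {0..<1}" "y \<in> {0..<1}"
    then have "0 < (y - x) * L" "(y - x) * L < 1 * L"
      using L by (simp, intro mult_strict_right_mono) auto
    \<comment> \<open>Half the angular difference lies strictly between 0 and \<open>pi\<close>,
      even for a full circle, because \<open>y - x < 1\<close>.\<close>
    then have "sin ((y * L - x * L) / 2) > 0"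
      using L by (intro sin_gt_zero) (simp_all add: left_diff_distrib)
    then show "?A x \<noteq> ?A y"
      using dist_circ[OF pd, of "y * L" "x * L"] by auto
  qed auto
  moreover have "geodesic_arc (path_image ?A)"
    unfolding geodesic_arc_def great_circle_def
  proof (intro conjI exI)
    show "closed (path_image ?A)" "path_image ?A \<noteq> {}" "connected (path_image ?A)"
      using path by (simp_all add: compact_imp_closed compact_path_image connected_path_image)
    show "subspace (span {p, d})" "dim (span {p, d}) = 2"
      using dim_span_orthonormal_pair[OF pd] by auto
    have "circ p d x \<in> span {p, d}" for x
      unfolding circ_def by (intro span_add span_scale span_base) auto
    then show "path_image ?A \<subseteq> span {p, d} \<inter> sphere 0 1"
      using norm_circ[OF pd] by (auto simp: path_image_def)
  qed simp
  moreover have "proportional_to_arc_length ?A"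
    unfolding proportional_to_arc_length_def
  proof (intro exI ballI)
    fix t :: real assume "t \<in> {0..1}"
    then show "arc_length ?A 0 t = ereal (t * L)"
      using L by (subst arc_length_circ[OF pd])
        (auto intro!: continuous_intros strict_mono_onI mult_strict_right_mono)
  qed
  ultimately show ?thesis
    using path by (simp add: directed_geodesic_arc_def)
qed

text \<open>A plane is larger than the line spanned by \<open>a\<close>, so it contains a unit
  vector orthogonal to \<open>a\<close>; coordinates in this basis are inner products.\<close>

lemma plane_orthonormal_basis:
  fixes a :: "'a::euclidean_space"
  assumes P: "subspace P" "dim P = 2" and a: "a \<in> P" "norm a = 1"
  obtains e where "orthonormal_pair a e" "\<And>x. x \<in> P \<Longrightarrow> x = (x \<bullet> a) *\<^sub>R a + (x \<bullet> e) *\<^sub>R e"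
proof -
  have "span {a} \<subseteq> P"
    using P a by (simp add: span_minimal)
  moreover have "dim (span {a}) \<le> 1"
    using dim_le_card'[of "{a}"] by simp
  then have "span {a} \<noteq> P"
    using P by auto
  ultimately have "span {a} \<subset> P"
    by auto
  moreover have "span P = P"
    by (rule span_eq_iff[THEN iffD2]) fact
  ultimately obtain x where x: "x \<noteq> 0" "x \<in> P" "\<And>y. y \<in> span {a} \<Longrightarrow> orthogonal x y"
    using orthogonal_to_subspace_exists_gen[of "{a}" P] by metis
  define e where "e = sgn x"
  have e: "orthonormal_pair a e"
    using x(1) x(3)[of a] a by (simp add: orthonormal_pair_def e_def norm_sgn sgn_div_norm orthogonal_def span_base inner_commute)
  have "e \<in> P"
    using x P by (simp add: e_def sgn_div_norm subspace_scale)
  then have "span {a, e} \<subseteq> P"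
    using a P by (simp add: span_minimal)
  then have span: "span {a, e} = P"
    using subspace_dim_equal[of "span {a, e}" P] P dim_span_orthonormal_pair[OF e] by simp
  have "x = (x \<bullet> a) *\<^sub>R a + (x \<bullet> e) *\<^sub>R e" if xP: "x \<in> P" for x
  proof -
    obtain r where "x - r *\<^sub>R a \<in> span {e}"
      using xP span_breakdown_eq[of x a "{e}"] unfolding span[symmetric] by blast
    then obtain s where "x - r *\<^sub>R a = s *\<^sub>R e"
      by (auto simp: span_singleton)
    then have "x = r *\<^sub>R a + s *\<^sub>R e"
      by (simp add: algebra_simps)
    then show ?thesis
      by (simp add: inner_add_left orthonormal_pairD[OF e])
  qed
  with e show thesis by (rule that)
qed

text \<open>A complex logarithm gives a continuous angle function; injectivity makes it monotone, and then
  the angle swept out is the arc length.\<close>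

lemma directed_geodesic_arc_imp_circ:
  assumes A: "directed_geodesic_arc A"
  obtains d L where "orthonormal_pair (A 0) d" "0 < L" "\<And>t. t \<in> {0..1} \<Longrightarrow> A t = circ (A 0) d (t * L)"
proof -
  from A obtain P L where cont: "continuous_on {0..1} A" and inj: "inj_on A {0..<1}"
    and P: "subspace P" "dim P = 2" and sub: "A ` {0..1} \<subseteq> P \<inter> sphere 0 1"
    and len: "\<And>t. t \<in> {0..1} \<Longrightarrow> arc_length A 0 t = ereal (t * L)"
    unfolding directed_geodesic_arc_def geodesic_arc_def great_circle_def
      proportional_to_arc_length_def path_def path_image_def by blast
  have AP: "A t \<in> P" "norm (A t) = 1" if "t \<in> {0..1}" for t
    using subsetD[OF sub, of "A t"] that by auto
  define a where "a = A 0"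
  obtain e where e: "orthonormal_pair a e"
    and coord: "\<And>x. x \<in> P \<Longrightarrow> x = (x \<bullet> a) *\<^sub>R a + (x \<bullet> e) *\<^sub>R e"
    using plane_orthonormal_basis[OF P AP[of 0]] by (auto simp: a_def)
  \<comment> \<open>Identifies the plane with the complex numbers, so that the arc becomes a path in
    the unit circle.\<close>
  define g where "g t = Complex (A t \<bullet> a) (A t \<bullet> e)" for t
  have norm_g: "norm (g t) = 1" if t: "t \<in> {0..1}" for t
  proof -
    have "1 = A t \<bullet> A t"
      using AP[OF t] by (simp add: norm_eq_1)
    also have "A t = (A t \<bullet> a) *\<^sub>R a + (A t \<bullet> e) *\<^sub>R e"
      using coord AP[OF t] by blast
    finally have "1 = (A t \<bullet> a)\<^sup>2 + (A t \<bullet> e)\<^sup>2"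
      by (simp add: inner_add_left inner_add_right orthonormal_pairD[OF e] power2_eq_square)
    then show ?thesis by (simp add: g_def cmod_def)
  qed
  have "continuous_on {0..1} g"
    unfolding g_def using cont by (intro continuous_intros)
  moreover have "g t \<noteq> 0" if "t \<in> {0..1}" for t
    using norm_g[OF that] by auto
  ultimately obtain h where h: "continuous_on {0..1} h" "\<And>t. t \<in> {0..1} \<Longrightarrow> g t = exp (h t)"
    using continuous_logarithm_on_contractible[of "{0..1::real}" g] convex_imp_contractible by auto
  define \<theta> where "\<theta> t = Im (h t)" for t
  have cont\<theta>: "continuous_on {0..1} \<theta>"
    unfolding \<theta>_def using h by (intro continuous_intros)
  have A\<theta>: "A t = circ a e (\<theta> t)" if t: "t \<in> {0..1}" for t
  proof -
    have "exp (Re (h t)) = 1"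
      using norm_g[OF t] h(2)[OF t] by (simp add: norm_exp_eq_Re)
    then have "g t = cis (\<theta> t)"
      using h(2)[OF t] by (simp add: exp_eq_polar \<theta>_def)
    then have coords: "A t \<bullet> a = cos (\<theta> t)" "A t \<bullet> e = sin (\<theta> t)"
      by (simp_all add: g_def complex_eq_iff)
    have "A t = (A t \<bullet> a) *\<^sub>R a + (A t \<bullet> e) *\<^sub>R e"
      using coord AP(1)[OF t] by blast
    then show ?thesis
      unfolding coords circ_def .
  qed
  have "inj_on \<theta> {0..<1}"
    using inj A\<theta> by (auto simp: inj_on_def)
  moreover have "continuous_on {0..<1} \<theta>"
    using cont\<theta> by (rule continuous_on_subset) auto
  ultimately have "strict_mono_on {0..<1} \<theta> \<or> strict_antimono_on {0..<1} \<theta>"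
    by (subst injective_eq_monotone_map[symmetric]) (auto intro: is_interval_co)
  \<comment> \<open>Negating both \<open>e\<close> and the angle leaves the curve unchanged and
    turns a decreasing angle into an increasing one.\<close>
  then obtain d \<phi> where d: "orthonormal_pair a d" and mono: "strict_mono_on {0..<1} \<phi>"
    and cont\<phi>: "continuous_on {0..1} \<phi>" and A\<phi>: "\<And>t. t \<in> {0..1} \<Longrightarrow> A t = circ a d (\<phi> t)"
  proof
    assume "strict_mono_on {0..<1} \<theta>"
    then show thesis using that e cont\<theta> A\<theta> by blast
  next
    assume "strict_antimono_on {0..<1} \<theta>"
    then have "strict_mono_on {0..<1} (\<lambda>t. - \<theta> t)"
      by (auto simp: monotone_on_def)
    moreover have "orthonormal_pair a (- e)"
      using e by (simp add: orthonormal_pair_def)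
    ultimately show thesis
      using that[of "- e" "\<lambda>t. - \<theta> t"] cont\<theta> A\<theta> by (auto simp: circ_def intro!: continuous_intros)
  qed
  have len\<phi>: "\<phi> t - \<phi> 0 = t * L" if t: "t \<in> {0..<1}" for t
  proof -
    have "arc_length A 0 t = arc_length (\<lambda>t. circ a d (\<phi> t)) 0 t"
      using A\<phi> t by (intro arc_length_cong) auto
    also have "\<dots> = ereal (\<phi> t - \<phi> 0)"
      using t by (intro arc_length_circ[OF d] monotone_on_subset[OF mono] continuous_on_subset[OF cont\<phi>]) auto
    finally show ?thesis using len[of t] t by simp
  qed
  have "L > 0"
    using len\<phi>[of "1/2"] strict_mono_onD[OF mono, of 0 "1/2"] by auto
  have "circ a d (\<phi> 0) = a" using A\<phi>[of 0] by (simp add: a_def)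
  then have "circ a d (\<phi> 0) \<bullet> a = 1" "circ a d (\<phi> 0) \<bullet> d = 0"
    using orthonormal_pairD[OF d] by auto
  then have \<phi>0: "cos (\<phi> 0) = 1" "sin (\<phi> 0) = 0"
    by (auto simp: circ_def inner_add_left orthonormal_pairD[OF d])
  \<comment> \<open>The start angle \<open>\<phi> 0\<close> drops out, having cosine 1 and sine 0.
    Injectivity gives the formula only for \<open>t < 1\<close>, as the arc may close up; continuity
    extends it to \<open>t = 1\<close>.\<close>
  have agree: "A t - circ a d (t * L) = 0" if t: "t \<in> {0..1}" for t
  proof (rule continuous_constant_on_closure[where S = "{0..<1}"
        and f = "\<lambda>t. A t - circ a d (t * L)"])
    show "continuous_on (closure {0..<1}) (\<lambda>t. A t - circ a d (t * L))"
      using cont by (auto intro!: continuous_intros)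
    show "t \<in> closure {0..<1}" using t by simp
    fix u :: real assume u: "u \<in> {0..<1}"
    have "circ a d (u * L) = circ a d (\<phi> u)"
      by (simp add: len\<phi>[OF u, symmetric] circ_def cos_diff sin_diff \<phi>0)
    then show "A u - circ a d (u * L) = 0" using A\<phi>[of u] u by simp
  qed
  have "A t = circ (A 0) d (t * L)" if "t \<in> {0..1}" for t
    using agree[OF that] unfolding a_def by simp
  with d[unfolded a_def] \<open>L > 0\<close> show thesis
    by (rule that)
qed

section \<open>Tangents at the two ends of an arc\<close>

text \<open>Here \<open>x\<close> is the starting angle and \<open>k\<close> the angular velocity,
  of which normalization keeps only the sign.\<close>

lemma unit_tangent_circ:
  assumes pd: "orthonormal_pair p d" and B: "\<And>t. t \<in> {0..1} \<Longrightarrow> B t = circ p d (x + t * k)"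
  shows "unit_tangent B = sgn k *\<^sub>R (cos x *\<^sub>R d - sin x *\<^sub>R p)"
proof -
  have "((\<lambda>t. circ p d (x + t * k)) has_vector_derivative k *\<^sub>R (cos x *\<^sub>R d - sin x *\<^sub>R p))
      (at 0 within {0..1})"
    unfolding circ_def by (auto intro!: derivative_eq_intros simp: algebra_simps)
  then have "(B has_vector_derivative k *\<^sub>R (cos x *\<^sub>R d - sin x *\<^sub>R p)) (at 0 within {0..1})"
    by (rule has_vector_derivative_transform[rotated 2]) (use B in auto)
  then have "vector_derivative B (at 0 within {0..1}) = k *\<^sub>R (cos x *\<^sub>R d - sin x *\<^sub>R p)"
    by (intro vector_derivative_within_closed_interval) auto
  moreover have "norm (cos x *\<^sub>R d - sin x *\<^sub>R p) = 1"
    by (simp add: norm_eq_1 inner_diff_left inner_diff_right orthonormal_pairD[OF pd]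
        flip: power2_eq_square)
  ultimately show ?thesis
    by (simp add: unit_tangent_def sgn_scaleR sgn_div_norm)
qed

declare leaving_arc.simps [simp del]

text \<open>The two thirds have angular velocities \<open>L / 3\<close> and \<open>- L / 3\<close>,
  since the last one is traversed backwards; both tangents point into the arc.\<close>

lemma unit_tangent_leaving_arc:
  assumes pd: "orthonormal_pair p d" and "0 < L"
    and A: "\<And>t. t \<in> {0..1} \<Longrightarrow> A e t = circ p d (t * L)"
  shows "unit_tangent (leaving_arc A (Tail_end e)) = d"
    and "unit_tangent (leaving_arc A (Head_end e)) = sin L *\<^sub>R p - cos L *\<^sub>R d"
proof -
  have "leaving_arc A (Tail_end e) t = circ p d (0 + t * (L / 3))" if "t \<in> {0..1}" for t
    using that A[of "t / 3"] by (simp add: subpath_def leaving_arc.simps)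
  from unit_tangent_circ[OF pd this] show "unit_tangent (leaving_arc A (Tail_end e)) = d"
    using \<open>0 < L\<close> by simp
  have "leaving_arc A (Head_end e) t = circ p d (L + t * (- L / 3))" if "t \<in> {0..1}" for t
  proof -
    have "(1 - t / 3) * L = L + t * (- L / 3)" by (simp add: algebra_simps)
    then show ?thesis
      using that A[of "1 - t / 3"] by (simp add: subpath_def leaving_arc.simps algebra_simps)
  qed
  from unit_tangent_circ[OF pd this]
  show "unit_tangent (leaving_arc A (Head_end e)) = sin L *\<^sub>R p - cos L *\<^sub>R d"
    using \<open>0 < L\<close> by (simp add: algebra_simps)
qed

text \<open>The reflection in the hyperplane orthogonal to \<open>p - q\<close>, which exchanges
  \<open>p\<close> and \<open>q\<close> if their norms agree. For \<open>p = q\<close> it is the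
  identity.\<close>

definition swap_reflection :: "'a::real_inner \<Rightarrow> 'a \<Rightarrow> 'a \<Rightarrow> 'a" where
  "swap_reflection p q x = x - (2 * (x \<bullet> (p - q)) / ((p - q) \<bullet> (p - q))) *\<^sub>R (p - q)"

lemma inner_swap_reflection:
  assumes "p \<noteq> q"
  shows "swap_reflection p q x \<bullet> swap_reflection p q y = x \<bullet> y"
proof -
  define v where "v = p - q"
  have "v \<bullet> v \<noteq> 0" using assms by (simp add: v_def)
  then show ?thesis
    unfolding swap_reflection_def v_def[symmetric]
    by (simp add: inner_diff_left inner_diff_right inner_commute field_simps)
qed

lemma swap_reflection_involution:
  assumes "p \<noteq> q"
  shows "swap_reflection p q (swap_reflection p q x) = x"
proof -
  have "(p - q) \<bullet> (p - q) \<noteq> 0" using assms by simp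
  then show ?thesis
    unfolding swap_reflection_def
    by (simp add: inner_diff_left[of x] diff_divide_distrib flip: scaleR_add_left)
qed

lemma swap_reflection_right:
  assumes "norm p = norm q"
  shows "swap_reflection p q q = p"
proof (cases "p = q")
  case False
  then have "(p - q) \<bullet> (p - q) \<noteq> 0" by simp
  moreover have "p \<bullet> p = q \<bullet> q"
    using assms by (simp add: norm_eq)
  \<comment> \<open>So the quotient in the reflection of \<open>q\<close> is
    \<open>- 1\<close>.\<close>
  then have "2 * (q \<bullet> (p - q)) = - ((p - q) \<bullet> (p - q))"
    by (simp add: inner_diff_left inner_diff_right inner_commute)
  ultimately show ?thesis
    unfolding swap_reflection_def by simp
qed (simp add: swap_reflection_def)

lemma swap_reflection_commute: "swap_reflection p q = swap_reflection q p"
proof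
  fix x
  have "x \<bullet> (p - q) = - (x \<bullet> (q - p))" by (simp add: inner_diff_right)
  moreover have "(p - q) \<bullet> (p - q) = (q - p) \<bullet> (q - p)"
    by (simp add: inner_diff_left inner_diff_right)
  moreover have "p - q = - (q - p)" by simp
  ultimately show "swap_reflection p q x = swap_reflection q p x"
    unfolding swap_reflection_def by (metis (no_types, lifting) minus_divide_left mult_minus_right scaleR_minus_left scaleR_minus_right minus_minus)
qed

text \<open>The reflection maps the arc to its reverse, hence exchanges the tangents at its ends;
  antipodal ends are included. For a closed arc \<open>cos L = 1\<close> and
  \<open>sin L = 0\<close>, which makes the tangents opposite.\<close>

lemma directed_geodesic_arc_tangents:
  assumes A: "directed_geodesic_arc (A e)"
  defines "p \<equiv> pathstart (A e)" and "q \<equiv> pathfinish (A e)"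
    and "u \<equiv> unit_tangent (leaving_arc A (Tail_end e))"
    and "w \<equiv> unit_tangent (leaving_arc A (Head_end e))"
  shows "norm u = 1" "norm w = 1" "p \<bullet> u = 0" "q \<bullet> w = 0"
    and "p = q \<Longrightarrow> w = - u" and "p \<noteq> q \<Longrightarrow> w = swap_reflection p q u"
proof -
  obtain d L where pd: "orthonormal_pair p d" and "0 < L"
    and circ: "\<And>t. t \<in> {0..1} \<Longrightarrow> A e t = circ p d (t * L)"
    using directed_geodesic_arc_imp_circ[OF A] unfolding p_def pathstart_def by blast
  note pdD = orthonormal_pairD[OF pd]
  have u: "u = d" and w: "w = sin L *\<^sub>R p - cos L *\<^sub>R d"
    unfolding u_def w_def using unit_tangent_leaving_arc[where A = A and e = e, OF pd \<open>0 < L\<close> circ] by auto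
  have q: "q = cos L *\<^sub>R p + sin L *\<^sub>R d"
    unfolding q_def pathfinish_def using circ[of 1] by (simp add: circ_def)
  show "norm u = 1" "p \<bullet> u = 0"
    using u pdD by auto
  show "norm w = 1"
    unfolding norm_eq_1 w
    by (simp add: inner_diff_left inner_diff_right pdD flip: power2_eq_square)
  show "q \<bullet> w = 0"
    unfolding q w by (simp add: inner_diff_right inner_add_left pdD)
  have cos: "p \<bullet> q = cos L" and sin: "d \<bullet> q = sin L"
    unfolding q by (simp_all add: inner_add_right pdD)
  show "w = - u" if "p = q"
    using cos sin that u w pdD by auto
  show "w = swap_reflection p q u" if "p \<noteq> q"
  proof -
    have "cos L \<noteq> 1"
    proof
      assume "cos L = 1"
      then have "q = p" using q by (simp add: cos_one_sin_zero)
      with that show False by simp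
    qed
    have pq: "p - q = (1 - cos L) *\<^sub>R p - sin L *\<^sub>R d"
      unfolding q by (simp add: algebra_simps)
    have "(p - q) \<bullet> (p - q) = (1 - cos L)\<^sup>2 + (sin L)\<^sup>2"
      unfolding pq by (simp add: inner_diff_left inner_diff_right pdD power2_eq_square)
    also have "\<dots> = 2 * (1 - cos L)"
      by (simp add: sin_squared_eq power2_eq_square algebra_simps)
    finally have sq: "(p - q) \<bullet> (p - q) = 2 * (1 - cos L)" .
    have "d \<bullet> (p - q) = - sin L"
      unfolding pq by (simp add: inner_diff_right pdD)
    then have "2 * (d \<bullet> (p - q)) / (2 * (1 - cos L)) = - (sin L / (1 - cos L))"
      using \<open>cos L \<noteq> 1\<close> by (simp add: field_simps)
    then have "swap_reflection p q u = d + (sin L / (1 - cos L)) *\<^sub>R (p - q)"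
      unfolding swap_reflection_def sq u by (simp only: scaleR_minus_left) simp
    also have "\<dots> = d + sin L *\<^sub>R p - ((sin L)\<^sup>2 / (1 - cos L)) *\<^sub>R d"
      unfolding pq using \<open>cos L \<noteq> 1\<close> by (simp add: scaleR_diff_right power2_eq_square)
    \<comment> \<open>Cancelling \<open>1 - cos L\<close> leaves \<open>d\<close> with the
      coefficient \<open>1 - (1 + cos L) = - cos L\<close>, as in \<open>w\<close>.\<close>
    also have "(sin L)\<^sup>2 = (1 + cos L) * (1 - cos L)"
      by (simp add: sin_squared_eq power2_eq_square algebra_simps)
    also have "\<dots> / (1 - cos L) = 1 + cos L"
      using \<open>cos L \<noteq> 1\<close> by simp
    finally show ?thesis
      unfolding w by (simp add: algebra_simps)
  qed
qed

section \<open>Triads of directions\<close>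

text \<open>For a unit tangent vector \<open>d\<close> at a unit vector \<open>p\<close>, these are
  three tangent directions at mutual angle \<open>2 * pi / 3\<close>. Inner products describe them
  without orienting the tangent plane.\<close>

definition triad :: "real^3 \<Rightarrow> real^3 \<Rightarrow> (real^3) set" where
  "triad p d = {x. p \<bullet> x = 0 \<and> norm x = 1 \<and> (x = d \<or> x \<bullet> d = - 1 / 2)}"

text \<open>In a basis of the tangent plane starting with \<open>b\<close>, both \<open>a\<close>
  and \<open>c\<close> have first coordinate -1/2 and second coordinate of square 3/4. They coincide
  or are mirror images, with inner product 1/4 - 3/4.\<close>

lemma triad_step:
  fixes p a b c :: "real^3"
  assumes p: "norm p = 1"
    and norm: "norm a = 1" "norm b = 1" "norm c = 1"
    and perp: "p \<bullet> a = 0" "p \<bullet> b = 0" "p \<bullet> c = 0"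
    and ab: "a \<bullet> b = - 1 / 2" and bc: "c \<bullet> b = - 1 / 2"
  shows "a = c \<or> a \<bullet> c = - 1 / 2"
proof -
  let ?P = "{x. p \<bullet> x = 0}"
  have "dim ?P = 2"
    using p by (subst dim_hyperplane) auto
  moreover have "b \<in> ?P" using perp by simp
  ultimately obtain e where e: "orthonormal_pair b e"
    and coord: "\<And>x. x \<in> ?P \<Longrightarrow> x = (x \<bullet> b) *\<^sub>R b + (x \<bullet> e) *\<^sub>R e"
    using plane_orthonormal_basis[OF subspace_hyperplane _ _ norm(2)] by blast
  have inner: "x \<bullet> y = (x \<bullet> b) * (y \<bullet> b) + (x \<bullet> e) * (y \<bullet> e)" if "x \<in> ?P" for x y
  proof -
    have "x \<bullet> y = ((x \<bullet> b) *\<^sub>R b + (x \<bullet> e) *\<^sub>R e) \<bullet> y"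
      by (rule arg_cong[where f = "\<lambda>z. z \<bullet> y", OF coord[OF that]])
    then show ?thesis
      by (simp only: inner_add_left inner_scaleR_left inner_commute[of b y] inner_commute[of e y])
  qed
  have "a \<bullet> a = 1" "c \<bullet> c = 1"
    using norm by (simp_all add: norm_eq_1)
  then have "(a \<bullet> e)\<^sup>2 = 3 / 4" "(c \<bullet> e)\<^sup>2 = 3 / 4"
    using inner[of a a] inner[of c c] perp ab bc by (simp_all add: power2_eq_square)
  then consider "a \<bullet> e = c \<bullet> e" | "a \<bullet> e = - (c \<bullet> e)"
    using power2_eq_iff[of "a \<bullet> e" "c \<bullet> e"] by auto
  then show ?thesis
  proof cases
    case 1
    then have "a = c"
      using coord[of a] coord[of c] perp ab bc by (metis mem_Collect_eq)
    then show ?thesis ..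
  next
    case 2
    then have "a \<bullet> c = 1 / 4 - (c \<bullet> e)\<^sup>2"
      using inner[of a c] perp ab bc by (simp add: power2_eq_square)
    then show ?thesis
      using \<open>(c \<bullet> e)\<^sup>2 = 3 / 4\<close> by simp
  qed
qed

text \<open>Each inclusion is \<open>triad_step\<close> with the generator of the smaller side as
  middle vector.\<close>

lemma triad_cong:
  assumes "norm p = 1" "norm d = 1" "norm d' = 1" "p \<bullet> d = 0" "p \<bullet> d' = 0" "d \<bullet> d' = - 1 / 2"
  shows "triad p d = triad p d'"
proof -
  have "triad p u \<subseteq> triad p w"
    if "norm u = 1" "norm w = 1" "p \<bullet> u = 0" "p \<bullet> w = 0" "u \<bullet> w = - 1 / 2" for u w
    using triad_step[OF assms(1) _ that(1,2) _ that(3,4)] that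
    by (auto simp: triad_def inner_commute)
  then show ?thesis
    using assms by (simp add: inner_commute subset_antisym)
qed

lemma triad_minus: "triad p (- d) = uminus ` triad p d"
proof -
  have "- x \<in> triad p d" if "x \<in> triad p (- d)" for x d
    using that by (auto simp: triad_def)
  from this[of _ d] this[of _ "- d"] show ?thesis
    by (force simp: image_iff)
qed

text \<open>The member \<open>d\<close> is missing from the negated triad: its inner product with
  \<open>- d\<close> is -1, not -1/2.\<close>

lemma triad_minus_neq:
  assumes "norm d = 1" "p \<bullet> d = 0"
  shows "uminus ` triad p d \<noteq> triad p d"
proof -
  have "d \<bullet> d = 1" using assms by (simp add: norm_eq_1)
  then have "d \<in> triad p d" "d \<notin> triad p (- d)"
    using assms by (auto simp: triad_def eq_neg_iff_add_eq_0 simp flip: scaleR_2)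
  then show ?thesis by (metis triad_minus)
qed

section \<open>Equiangular immersions and bipartiteness\<close>

lemma equiangular_inner:
  assumes "equiangular D A" "v \<in> verts D" "h \<in> ends_at D v" "h' \<in> ends_at D v" "h \<noteq> h'"
    and norm: "norm (unit_tangent (leaving_arc A h)) = 1" "norm (unit_tangent (leaving_arc A h')) = 1"
  shows "unit_tangent (leaving_arc A h) \<bullet> unit_tangent (leaving_arc A h') = - 1 / 2"
proof -
  let ?c = "unit_tangent (leaving_arc A h) \<bullet> unit_tangent (leaving_arc A h')"
  have "arccos ?c = 2 * pi / 3"
    using assms by (auto simp: equiangular_def pairwise_def spherical_angle_def)
  \<comment> \<open>\<open>arccos\<close> is inverted by \<open>cos\<close> only on [-1, 1], where
    Cauchy-Schwarz places the inner product.\<close>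
  moreover have "\<bar>?c\<bar> \<le> 1"
    using Cauchy_Schwarz_ineq2[of "unit_tangent (leaving_arc A h)"] norm by (metis mult_1)
  ultimately show ?thesis
    using cos_arccos_abs[of ?c] cos_120 by metis
qed

text \<open>Requiring only an inclusion lets one argument serve one and two points. Along an edge
  exactly one of position and sign of the triad changes.\<close>

lemma two_point_immersion_imp_bipartite:
  assumes G: "finite_graph G"
    and imm: "equiangular_immersion G \<gamma>" and \<gamma>: "\<gamma> ` vertices G \<subseteq> {p, q}"
    and pq: "p \<noteq> q" "norm p = 1" "norm q = 1"
  shows "bipartite G"
proof -
  obtain D A where D: "orientation_of D G" and "immersion D \<gamma> A" and eq: "equiangular D A"
    using imm by (auto simp: equiangular_immersion_def)
  have verts: "verts D = vertices G" and arcs: "arcs D = edges G"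
    and ends: "\<And>e. e \<in> edges G \<Longrightarrow> ends G e = Upair (tail D e) (head D e)"
    using D by (auto simp: orientation_of_def)
  have arc: "directed_geodesic_arc (A e)" "pathstart (A e) = \<gamma> (tail D e)" "pathfinish (A e) = \<gamma> (head D e)"
    if "e \<in> edges G" for e
    using \<open>immersion D \<gamma> A\<close> that by (auto simp: immersion_def arcs)
  have inV: "tail D e \<in> vertices G" "head D e \<in> vertices G" if "e \<in> edges G" for e
    using G that ends[OF that] by (auto simp: finite_graph_def)
  define \<tau> where "\<tau> h = unit_tangent (leaving_arc A h)" for h
  have tangents: "norm (\<tau> (Tail_end e)) = 1" "norm (\<tau> (Head_end e)) = 1"
    "\<gamma> (tail D e) \<bullet> \<tau> (Tail_end e) = 0" "\<gamma> (head D e) \<bullet> \<tau> (Head_end e) = 0"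
    "\<gamma> (tail D e) = \<gamma> (head D e) \<Longrightarrow> \<tau> (Head_end e) = - \<tau> (Tail_end e)"
    "\<gamma> (tail D e) \<noteq> \<gamma> (head D e) \<Longrightarrow>
      \<tau> (Head_end e) = swap_reflection (\<gamma> (tail D e)) (\<gamma> (head D e)) (\<tau> (Tail_end e))"
    if e: "e \<in> edges G" for e
    using directed_geodesic_arc_tangents[of A e, OF arc(1)[OF e]] unfolding arc(2,3)[OF e] \<tau>_def
    by blast+
  define to_p where "to_p v x = (if \<gamma> v = p then x else swap_reflection p q x)" for v x
  have \<tau>: "norm (\<tau> h) = 1" "\<gamma> v \<bullet> \<tau> h = 0" if "h \<in> ends_at D v" for h v
    using that tangents(1-4) by (auto simp: ends_at_def arcs)
  have inner_to_p: "to_p v x \<bullet> to_p v y = x \<bullet> y" for v x y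
    using inner_swap_reflection[OF pq(1)] by (simp add: to_p_def)
  have to_p_\<gamma>: "to_p v (\<gamma> v) = p" if "v \<in> vertices G" for v
    using \<gamma> that pq swap_reflection_right[of p q] by (auto simp: to_p_def)
  have to_p: "norm (to_p v (\<tau> h)) = 1" "p \<bullet> to_p v (\<tau> h) = 0"
    if "v \<in> vertices G" "h \<in> ends_at D v" for v h
  proof -
    show "norm (to_p v (\<tau> h)) = 1"
      using \<tau>[OF that(2)] by (simp add: norm_eq_1 inner_to_p)
    show "p \<bullet> to_p v (\<tau> h) = 0"
      using inner_to_p[of v "\<gamma> v" "\<tau> h"] \<tau>[OF that(2)] to_p_\<gamma>[OF that(1)] by simp
  qed
  \<comment> \<open>The triad at \<open>v\<close>, moved to \<open>p\<close>. The end chosen is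
    immaterial: \<open>to_p\<close> preserves inner products, so all tangents at \<open>v\<close>
    yield the same triad.\<close>
  define F where "F v = triad p (to_p v (\<tau> (SOME h. h \<in> ends_at D v)))" for v
  have F: "F v = triad p (to_p v (\<tau> h))" if v: "v \<in> vertices G" and h: "h \<in> ends_at D v" for v h
  proof -
    define k where "k = (SOME h. h \<in> ends_at D v)"
    have k: "k \<in> ends_at D v"
      unfolding k_def using h by (rule someI)
    have "triad p (to_p v (\<tau> k)) = triad p (to_p v (\<tau> h))"
    proof (cases "k = h")
      case False
      then have "\<tau> k \<bullet> \<tau> h = - 1 / 2"
        unfolding \<tau>_def using v h k \<tau>(1)[unfolded \<tau>_def]
        by (intro equiangular_inner[OF eq]) (auto simp: verts)
      then show ?thesis
        using to_p[OF v] h k pq by (intro triad_cong) (auto simp: inner_to_p)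
    qed simp
    then show ?thesis by (simp add: F_def k_def)
  qed
  have ends_at: "Tail_end e \<in> ends_at D (tail D e)" "Head_end e \<in> ends_at D (head D e)"
    if "e \<in> edges G" for e
    using that by (auto simp: ends_at_def arcs)
  have F_same: "F (head D e) = uminus ` F (tail D e)" "F (head D e) \<noteq> F (tail D e)"
    if e: "e \<in> edges G" and same: "\<gamma> (tail D e) = \<gamma> (head D e)" for e
  proof -
    have "to_p (head D e) (\<tau> (Head_end e)) = - to_p (tail D e) (\<tau> (Tail_end e))"
      using tangents(5)[OF e same] same by (simp add: to_p_def swap_reflection_def)
    then show "F (head D e) = uminus ` F (tail D e)"
      using F[OF inV(1)[OF e] ends_at(1)[OF e]] F[OF inV(2)[OF e] ends_at(2)[OF e]]
      by (simp add: triad_minus)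
    then show "F (head D e) \<noteq> F (tail D e)"
      using triad_minus_neq[OF to_p[OF inV(1)[OF e] ends_at(1)[OF e]]]
        F[OF inV(1)[OF e] ends_at(1)[OF e]] by simp
  qed
  \<comment> \<open>Exactly one end lies over \<open>p\<close>; at the other, \<open>to_p\<close>
    undoes the reflection along the edge.\<close>
  have F_diff: "F (head D e) = F (tail D e)"
    if e: "e \<in> edges G" and diff: "\<gamma> (tail D e) \<noteq> \<gamma> (head D e)" for e
  proof -
    have "(\<gamma> (tail D e) = p \<and> \<gamma> (head D e) = q) \<or> (\<gamma> (tail D e) = q \<and> \<gamma> (head D e) = p)"
      using diff \<gamma> inV[OF e] by auto
    moreover from this have "swap_reflection (\<gamma> (tail D e)) (\<gamma> (head D e)) = swap_reflection p q"
      using swap_reflection_commute by metis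
    then have "\<tau> (Head_end e) = swap_reflection p q (\<tau> (Tail_end e))"
      using tangents(6)[OF e diff] by simp
    ultimately have "to_p (head D e) (\<tau> (Head_end e)) = to_p (tail D e) (\<tau> (Tail_end e))"
      using pq(1) swap_reflection_involution[OF pq(1)] by (auto simp: to_p_def)
    then show ?thesis
      using F[OF inV(1)[OF e] ends_at(1)[OF e]] F[OF inV(2)[OF e] ends_at(2)[OF e]] by simp
  qed
  \<comment> \<open>Selects one member from each pair of a set and its negative. It depends on the
    pair only, and so defines a sign for triads.\<close>
  define rep :: "(real^3) set \<Rightarrow> (real^3) set" where "rep T = (SOME U. U \<in> {T, uminus ` T})" for T
  have rep: "rep T = T \<or> rep T = uminus ` T" for T
    using someI[of "\<lambda>U. U \<in> {T, uminus ` T}" T] by (auto simp: rep_def)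
  have rep_minus: "rep (uminus ` T) = rep T" for T
    unfolding rep_def by (simp add: image_image insert_commute)
  define colour where "colour v \<longleftrightarrow> (\<gamma> v = p \<longleftrightarrow> rep (F v) = F v)" for v
  have colour: "colour (tail D e) \<noteq> colour (head D e)" if e: "e \<in> edges G" for e
  proof (cases "\<gamma> (tail D e) = \<gamma> (head D e)")
    case True
    \<comment> \<open>The two triads are distinct and opposite, so their common representative is
      exactly one of them.\<close>
    then have "(rep (F (head D e)) = F (head D e)) \<noteq> (rep (F (tail D e)) = F (tail D e))"
      using F_same[OF e True] rep rep_minus by metis
    with True show ?thesis by (auto simp: colour_def)
  next
    case False
    then have "(\<gamma> (tail D e) = p) \<noteq> (\<gamma> (head D e) = p)"
      using \<gamma> inV[OF e] by auto
    with F_diff[OF e False] show ?thesis by (auto simp: colour_def)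
  qed
  show ?thesis
    unfolding bipartite_def
  proof (intro exI conjI ballI)
    let ?X = "{v \<in> vertices G. colour v}" and ?Y = "{v \<in> vertices G. \<not> colour v}"
    show "?X \<union> ?Y = vertices G" "?X \<inter> ?Y = {}" by auto
    fix e assume e: "e \<in> edges G"
    show "\<exists>x\<in>?X. \<exists>y\<in>?Y. ends G e = Upair x y"
    proof (cases "colour (tail D e)")
      case True
      then show ?thesis
        using colour[OF e] inV[OF e] ends[OF e]
        by (intro bexI[of _ "tail D e"] bexI[of _ "head D e"]) auto
    next
      case False
      then show ?thesis
        using colour[OF e] inV[OF e] ends[OF e]
        by (intro bexI[of _ "head D e"] bexI[of _ "tail D e"]) auto
    qed
  qed
qed

section \<open>From a 2-colouring to equiangular immersions\<close>

lemma bipartite_imp_immersion: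
  fixes G :: "('v, 'e) multigraph"
  assumes cubic: "cubic_graph G" and bip: "bipartite G"
  obtains X Y and p :: "real^3"
  where "X \<union> Y = vertices G" "X \<inter> Y = {}" "X \<noteq> {}" "Y \<noteq> {}" "norm p = 1"
    "\<forall>L\<in>{pi, 2 * pi}. equiangular_immersion G (\<lambda>v. if v \<in> X then p else cos L *\<^sub>R p)"
proof -
  obtain X Y where XY: "X \<union> Y = vertices G" "X \<inter> Y = {}"
    and "\<forall>e\<in>edges G. \<exists>x\<in>X. \<exists>y\<in>Y. ends G e = Upair x y"
    using bip unfolding bipartite_def by blast
  then obtain a b where ab: "\<And>e. e \<in> edges G \<Longrightarrow> a e \<in> X \<and> b e \<in> Y \<and> ends G e = Upair (a e) (b e)"
    by metis
  have fin: "finite (vertices G)" "finite (edges G)" and "vertices G \<noteq> {}"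
    and degree: "\<And>v. v \<in> vertices G \<Longrightarrow> degree G v = 3"
    using cubic by (auto simp: cubic_graph_def finite_graph_def)
  \<comment> \<open>Without loops, the degree of a vertex is the size of the fibre of
    \<open>a\<close> or \<open>b\<close> over it.\<close>
  have "ends G e \<noteq> Upair v v" if "e \<in> edges G" for e v
    using ab[OF that] XY by auto
  then have no_loops: "{e \<in> edges G. ends G e = Upair v v} = {}" for v by blast
  have cardX: "card {e \<in> edges G. a e = v} = 3" if "v \<in> X" for v
  proof -
    have "{e \<in> edges G. v \<in> set_uprod (ends G e)} = {e \<in> edges G. a e = v}"
      using ab XY that by fastforce
    then show ?thesis
      using degree[of v] XY that no_loops[of v] by (auto simp: degree_def)
  qed
  have cardY: "card {e \<in> edges G. b e = v} = 3" if "v \<in> Y" for v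
  proof -
    have "{e \<in> edges G. v \<in> set_uprod (ends G e)} = {e \<in> edges G. b e = v}"
      using ab XY that by fastforce
    then show ?thesis
      using degree[of v] XY that no_loops[of v] by (auto simp: degree_def)
  qed
  have "finite (X \<union> Y)"
    using XY(1) fin(1) by simp
  then have finXY: "finite X" "finite Y"
    by simp_all
  have img: "a ` edges G \<subseteq> X" "b ` edges G \<subseteq> Y"
    using ab by auto
  from koenig_edge_colouring[OF fin(2) finXY img(1) cardX img(2) cardY]
  obtain c :: "'e \<Rightarrow> nat" where c3: "\<forall>e\<in>edges G. c e < 3"
    and c: "\<forall>e\<in>edges G. \<forall>e'\<in>edges G. e \<noteq> e' \<longrightarrow> a e = a e' \<or> b e = b e' \<longrightarrow> c e \<noteq> c e'"
    by auto
  \<comment> \<open>The ends of an edge witness that both classes are nonempty, so that both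
    prescribed positions occur.\<close>
  have "edges G \<noteq> {}"
  proof
    assume "edges G = {}"
    with \<open>vertices G \<noteq> {}\<close> degree show False by (force simp: degree_def)
  qed
  then have ne: "X \<noteq> {}" "Y \<noteq> {}" using ab by auto
  define p :: "real^3" where "p = axis 3 1"
  define d :: "nat \<Rightarrow> real^3" where "d i = circ (axis 1 1) (axis 2 1) (real i * (2 * pi / 3))" for i
  have axes: "orthonormal_pair (axis 1 1 :: real^3) (axis 2 1)"
    by (simp add: orthonormal_pair_def inner_axis_axis)
  have pd: "orthonormal_pair p (d i)" for i
    using norm_circ[OF axes]
    by (simp add: orthonormal_pair_def p_def d_def circ_def inner_add_right inner_axis_axis)
  have dd: "d i \<bullet> d j = - 1 / 2" if "i < 3" "j < 3" "i \<noteq> j" for i j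
  proof -
    have inner: "d i \<bullet> d j = cos ((real i - real j) * (2 * pi / 3))"
      by (simp only: d_def inner_circ_circ[OF axes] left_diff_distrib)
    have "i \<in> {0, 1, 2}" "j \<in> {0, 1, 2}" using that by auto
    \<comment> \<open>Up to sign, the angles between distinct directions are
      \<open>2 * pi / 3\<close> and \<open>4 * pi / 3\<close>, both with cosine -1/2.\<close>
    then have "real i - real j \<in> {1, - 1, 2, - 2}"
      using \<open>i \<noteq> j\<close> by auto
    moreover have cos_240: "cos (2 * (2 * pi / 3)) = - 1 / 2"
      by (simp only: cos_double_cos cos_120) (simp add: power2_eq_square)
    ultimately show ?thesis
      unfolding inner
      by (elim insertE emptyE) (simp_all only: mult_1 mult_minus_left cos_minus cos_120)
  qed
  have "equiangular_immersion G (\<lambda>v. if v \<in> X then p else cos L *\<^sub>R p)" if L: "L \<in> {pi, 2 * pi}" for L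
  proof -
    define D where "D = \<lparr>verts = vertices G, arcs = edges G, tail = a, head = b\<rparr>"
    \<comment> \<open>Both cases at once: the edge leaves \<open>p\<close> in the direction of its
      colour and, after the angle \<open>L\<close>, reaches \<open>- p\<close> for \<open>pi\<close>
      and \<open>p\<close> for \<open>2 * pi\<close>.\<close>
    define A where "A e t = circ p (d (c e)) (t * L)" for e t
    have L0: "0 < L" "L \<le> 2 * pi" "sin L = 0" "cos L * cos L = 1"
      using L by auto
    \<comment> \<open>As \<open>sin L = 0\<close>, all head tangents are colour directions with the
      common factor \<open>- cos L\<close>, which has square 1 and cancels in inner
      products.\<close>
    have tail: "unit_tangent (leaving_arc A (Tail_end e)) = d (c e)"
      and head: "unit_tangent (leaving_arc A (Head_end e)) = - cos L *\<^sub>R d (c e)" for e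
      using unit_tangent_leaving_arc[where A = A and e = e, OF pd L0(1) A_def] L0(3) by simp_all
    have "orientation_of D G"
      using ab by (auto simp: orientation_of_def D_def)
    moreover have "immersion D (\<lambda>v. if v \<in> X then p else cos L *\<^sub>R p) A"
      unfolding immersion_def
    proof (intro conjI ballI)
      fix v
      have "\<bar>cos L\<bar> = 1" using L by auto
      then show "(if v \<in> X then p else cos L *\<^sub>R p) \<in> sphere 0 1"
        using pd[of 0] by (simp add: orthonormal_pair_def)
    next
      fix e assume "e \<in> arcs D"
      then have e: "e \<in> edges G" by (simp add: D_def)
      show "directed_geodesic_arc (A e)"
        using directed_geodesic_arc_circ[OF pd L0(1,2)] unfolding A_def .
      show "pathstart (A e) = (if tail D e \<in> X then p else cos L *\<^sub>R p)"
        using ab[OF e] by (simp add: pathstart_def A_def circ_def D_def)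
      show "pathfinish (A e) = (if head D e \<in> X then p else cos L *\<^sub>R p)"
        using ab[OF e] XY L0 by (auto simp: pathfinish_def A_def circ_def D_def)
    qed
    moreover have "equiangular D A"
      unfolding equiangular_def
    proof (intro ballI pairwiseI)
      fix v h h' assume h: "h \<in> ends_at D v" "h' \<in> ends_at D v" "h \<noteq> h'"
      \<comment> \<open>All edges run from \<open>X\<close> to \<open>Y\<close>, so the ends at a
        vertex are all tails or all heads.\<close>
      then consider e e' where "h = Tail_end e" "h' = Tail_end e'" "e \<in> edges G" "e' \<in> edges G" "a e = a e'"
        | e e' where "h = Head_end e" "h' = Head_end e'" "e \<in> edges G" "e' \<in> edges G" "b e = b e'"
        using ab XY(2) by (fastforce simp: ends_at_def D_def)
      then have "unit_tangent (leaving_arc A h) \<bullet> unit_tangent (leaving_arc A h') = - 1 / 2"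
      proof cases
        case 1
        then have "d (c e) \<bullet> d (c e') = - 1 / 2"
          using c c3 h(3) by (intro dd) auto
        with 1 show ?thesis
          by (simp add: tail)
      next
        case 2
        then have "d (c e) \<bullet> d (c e') = - 1 / 2"
          using c c3 h(3) by (intro dd) auto
        then have "(cos L * cos L) * (d (c e) \<bullet> d (c e')) = - 1 / 2"
          using L0(4) by simp
        with 2 show ?thesis
          by (simp add: head mult.assoc)
      qed
      moreover have "arccos (- 1 / 2) = 2 * pi / 3"
        using arccos_cos[of "2 * pi / 3"] cos_120 by simp
      ultimately show "spherical_angle (leaving_arc A h) (leaving_arc A h') = 2 * pi / 3"
        by (simp add: spherical_angle_def)
    qed
    ultimately show ?thesis
      unfolding equiangular_immersion_def by blast
  qed
  with XY ne pd[of 0] show thesis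
    by (intro that[of X Y p]) (auto simp: orthonormal_pair_def)
qed

section \<open>The two equivalences\<close>

lemma unit_vector_neq_minus:
  fixes p :: "'a::real_normed_vector"
  shows "norm p = 1 \<Longrightarrow> p \<noteq> - p"
  by (auto simp: eq_neg_iff_add_eq_0 simp flip: scaleR_2)

lemma equiangular_immersion_norm:
  assumes "equiangular_immersion G \<gamma>" "x \<in> \<gamma> ` vertices G"
  shows "norm x = 1"
proof -
  obtain D A where "orientation_of D G" "immersion D \<gamma> A"
    using assms(1) unfolding equiangular_immersion_def by blast
  then have "\<forall>v\<in>vertices G. \<gamma> v \<in> sphere 0 1"
    by (simp add: orientation_of_def immersion_def)
  with assms(2) show ?thesis by auto
qed

theorem theorem4p7:
  fixes G :: "('v, 'e) multigraph"
  assumes "cubic_graph G"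
  shows "((\<exists>\<gamma>. equiangular_immersion G \<gamma> \<and> card (\<gamma> ` vertices G) = 1) \<longleftrightarrow>
          (\<exists>\<gamma>. equiangular_immersion G \<gamma> \<and> card (\<gamma> ` vertices G) = 2)) \<and>
         ((\<exists>\<gamma>. equiangular_immersion G \<gamma> \<and> card (\<gamma> ` vertices G) = 2) \<longleftrightarrow>
          bipartite G)"
proof -
  have G: "finite_graph G"
    using assms by (simp add: cubic_graph_def)
  have one: "bipartite G" if "equiangular_immersion G \<gamma>" "card (\<gamma> ` vertices G) = 1" for \<gamma>
  proof -
    obtain p where p: "\<gamma> ` vertices G = {p}"
      using \<open>card (\<gamma> ` vertices G) = 1\<close> by (auto simp: card_1_singleton_iff)
    then have "norm p = 1"
      using equiangular_immersion_norm[OF that(1), of p] by simp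
    moreover from this have "p \<noteq> - p"
      by (rule unit_vector_neq_minus)
    ultimately show ?thesis
      using two_point_immersion_imp_bipartite[OF G that(1), of p "- p"] p by auto
  qed
  have two: "bipartite G" if "equiangular_immersion G \<gamma>" "card (\<gamma> ` vertices G) = 2" for \<gamma>
  proof -
    obtain p q where pq: "\<gamma> ` vertices G = {p, q}" "p \<noteq> q"
      using \<open>card (\<gamma> ` vertices G) = 2\<close> by (auto simp: card_2_iff)
    then have "norm p = 1" "norm q = 1"
      using equiangular_immersion_norm[OF that(1)] by simp_all
    with pq show ?thesis
      using two_point_immersion_imp_bipartite[OF G that(1), of p q] by simp
  qed
  have "(\<exists>\<gamma>. equiangular_immersion G \<gamma> \<and> card (\<gamma> ` vertices G) = 1) \<and>
      (\<exists>\<gamma>. equiangular_immersion G \<gamma> \<and> card (\<gamma> ` vertices G) = 2)" if bip: "bipartite G"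
  proof -
    obtain X Y and p :: "real^3" where XY: "X \<union> Y = vertices G" "X \<inter> Y = {}" "X \<noteq> {}" "Y \<noteq> {}"
      and p: "norm p = 1"
      and imm: "\<forall>L\<in>{pi, 2 * pi}. equiangular_immersion G (\<lambda>v. if v \<in> X then p else cos L *\<^sub>R p)"
      using bipartite_imp_immersion[OF assms bip] by blast
    \<comment> \<open>Both values occur because \<open>X\<close> and \<open>Y\<close> are nonempty;
      \<open>r = p\<close> is the one-point case and \<open>r = - p\<close> the two-point
      case.\<close>
    have image: "(\<lambda>v. if v \<in> X then p else r) ` vertices G = {p, r}" for r
      using XY by (auto simp: image_iff)
    have "p \<noteq> - p"
      using p by (rule unit_vector_neq_minus)
    then have "card ((\<lambda>v. if v \<in> X then p else - p) ` vertices G) = 2"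
      unfolding image by simp
    moreover have "card ((\<lambda>v. if v \<in> X then p else p) ` vertices G) = 1"
      unfolding image by simp
    moreover have "equiangular_immersion G (\<lambda>v. if v \<in> X then p else - p)"
      "equiangular_immersion G (\<lambda>v. if v \<in> X then p else p)"
      using bspec[OF imm, of pi] bspec[OF imm, of "2 * pi"]
      unfolding cos_pi cos_two_pi scaleR_one scaleR_minus_left by simp_all
    ultimately show ?thesis by blast
  qed
  with one two show ?thesis by blast
qed

end
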